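(* Let $\mathcal{F}$ be a real Hilbert space, let $\Phi:\mathcal{F}\to(-\infty,\infty]$ be a generator with $\mathcal{A}=\operatorname{int}(\operatorname{dom}\Phi)$, and let $A$ and $B$ be bounded self-adjoint positive definite operators on $\mathcal{F}$. For $f,g\in\mathcal{A}$ define $$d_\Phi^{gsb}(f,g)=d_\Phi(f,g)+d_\Phi(g,f)+\tfrac12\|f-g\|_A^2+\tfrac12\|\nabla\Phi(f)-\nabla\Phi(g)\|_B^2,$$ where $\|\cdot\|_A^2=\langle\cdot,A\,\cdot\rangle_{\mathcal{F}}$ and $\|\cdot\|_B^2=\langle\cdot,B\,\cdot\rangle_{\mathcal{F}}$. Let $\mathcal{F}^2$ be the product Hilbert space with inner product $\langle(f_1,f_2),(g_1,g_2)\rangle_{\mathcal{F}^2}=\langle f_1,g_1\rangle_{\mathcal{F}}+\langle f_2,g_2\rangle_{\mathcal{F}}$, and define the self-adjoint operator $M:\mathcal{F}^2\to\mathcal{F}^2$ by $$M\big((f,g)\big)=(Af+g,\ f+Bg).$$ If $M$ is positive semidefinite on $\mathcal{F}^2$, then $(f,g)\mapsto\sqrt{d_\Phi^{gsb}(f,g)}$ is a metric on $\mathcal{A}$. Moreover, a sufficient condition for $M$ to be positive semidefinite is that $A$ is strongly positive, that is, there is $\alpha>0$ with $\langle f,Af\rangle_{\mathcal{F}}\ge\alpha\|f\|_{\mathcal{F}}^2$ for all $f\in\mathcal{F}$, and $B\succeq A^{-1}$.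
   Context: A function $\Phi:\mathcal{F}\to(-\infty,\infty]$ on a real Hilbert space $\mathcal{F}$ is called a generator if it is proper, lower semicontinuous, strictly convex, and Fréchet differentiable on $\mathcal{A}=\operatorname{int}(\operatorname{dom}\Phi)\neq\emptyset$. The Fréchet gradient $\nabla\Phi(g)\in\mathcal{F}$ is the Riesz representer of the Fréchet derivative. The functional Bregman divergence generated by $\Phi$ is, for $f,g\in\mathcal{A}$, $d_\Phi(f,g)=\Phi(f)-\Phi(g)-\langle\nabla\Phi(g),f-g\rangle_{\mathcal{F}}$. For bounded self-adjoint operators, $B\succeq C$ (Löwner order) means $\langle f,(B-C)f\rangle\ge 0$ for all $f$; positive semidefinite means $\succeq 0$, and positive definite means $\langle f,Af\rangle>0$ for all $f\neq0$. *)

theory Defs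
  imports "HOL-Analysis.Analysis"
begin

text \<open>
  A real Hilbert space is a type of sort \<open>{real_inner, complete_space}\<close>; the product
  Hilbert space is the product type with the library's \<open>real_inner\<close> instance
  (see \<open>inner_prod_def\<close>). Functions into \<open>(-\<infinity>, \<infinity>]\<close> are \<open>ereal\<close>-valued functions
  that avoid \<open>-\<infinity>\<close>.
\<close>

definition effdom :: "('a \<Rightarrow> ereal) \<Rightarrow> 'a set"
  where "effdom \<Phi> = {x. \<Phi> x < \<infinity>}"

definition proper_fun :: "('a \<Rightarrow> ereal) \<Rightarrow> bool"
  where "proper_fun \<Phi> \<longleftrightarrow> (\<forall>x. \<Phi> x \<noteq> -\<infinity>) \<and> effdom \<Phi> \<noteq> {}"

definition lower_semicont :: "('a::topological_space \<Rightarrow> ereal) \<Rightarrow> bool"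
  where "lower_semicont \<Phi> \<longleftrightarrow> (\<forall>x. \<Phi> x \<le> Liminf (at x) \<Phi>)"

definition strictly_convex :: "('a::real_vector \<Rightarrow> ereal) \<Rightarrow> bool"
  where "strictly_convex \<Phi> \<longleftrightarrow>
    (\<forall>x\<in>effdom \<Phi>. \<forall>y\<in>effdom \<Phi>. \<forall>t. x \<noteq> y \<longrightarrow> 0 < t \<longrightarrow> t < 1 \<longrightarrow>
      \<Phi> ((1 - t) *\<^sub>R x + t *\<^sub>R y) < ereal (1 - t) * \<Phi> x + ereal t * \<Phi> y)"

text \<open>
  Since \<open>\<Phi>\<close> is finite on \<open>effdom \<Phi>\<close>, derivatives at interior points are those of
  \<open>real_of_ereal \<circ> \<Phi>\<close>; its values outside \<open>effdom \<Phi>\<close> play no role there.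
\<close>

definition generator :: "('a::real_inner \<Rightarrow> ereal) \<Rightarrow> bool"
  where "generator \<Phi> \<longleftrightarrow>
    proper_fun \<Phi> \<and> lower_semicont \<Phi> \<and> strictly_convex \<Phi> \<and>
    interior (effdom \<Phi>) \<noteq> {} \<and>
    (\<forall>x\<in>interior (effdom \<Phi>). (real_of_ereal \<circ> \<Phi>) differentiable (at x))"

text \<open>
  \<open>GDERIV F g :> D\<close> says that the Frechet derivative of \<open>F\<close> at \<open>g\<close> is \<open>\<lambda>h. h \<bullet> D\<close>, so that \<open>D\<close>
  is its Riesz representer.
\<close>

definition grad :: "('a::real_inner \<Rightarrow> ereal) \<Rightarrow> 'a \<Rightarrow> 'a"
  where "grad \<Phi> g = (THE D. GDERIV (real_of_ereal \<circ> \<Phi>) g :> D)"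

definition bregman :: "('a::real_inner \<Rightarrow> ereal) \<Rightarrow> 'a \<Rightarrow> 'a \<Rightarrow> real"
  where "bregman \<Phi> f g =
    real_of_ereal (\<Phi> f) - real_of_ereal (\<Phi> g) - grad \<Phi> g \<bullet> (f - g)"

definition self_adjoint :: "('a::real_inner \<Rightarrow> 'a) \<Rightarrow> bool"
  where "self_adjoint T \<longleftrightarrow> (\<forall>x y. T x \<bullet> y = x \<bullet> T y)"

definition loewner_ge :: "('a::real_inner \<Rightarrow> 'a) \<Rightarrow> ('a \<Rightarrow> 'a) \<Rightarrow> bool"
  where "loewner_ge B C \<longleftrightarrow> (\<forall>f. f \<bullet> (B f - C f) \<ge> 0)"

definition pos_semidef :: "('a::real_inner \<Rightarrow> 'a) \<Rightarrow> bool"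
  where "pos_semidef T \<longleftrightarrow> loewner_ge T (\<lambda>_. 0)"

definition pos_def :: "('a::real_inner \<Rightarrow> 'a) \<Rightarrow> bool"
  where "pos_def T \<longleftrightarrow> (\<forall>f. f \<noteq> 0 \<longrightarrow> f \<bullet> T f > 0)"

text \<open>
  A bounded self-adjoint strongly positive operator on a Hilbert space is bijective, so for such
  a \<open>T\<close> the function inverse \<open>inv T\<close> is the operator inverse.
\<close>

definition strongly_pos :: "('a::real_inner \<Rightarrow> 'a) \<Rightarrow> bool"
  where "strongly_pos T \<longleftrightarrow> (\<exists>\<alpha>>0. \<forall>f. f \<bullet> T f \<ge> \<alpha> * (norm f)\<^sup>2)"

definition weighted_norm_sq :: "('a::real_inner \<Rightarrow> 'a) \<Rightarrow> 'a \<Rightarrow> real"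
  where "weighted_norm_sq T f = f \<bullet> T f"

definition bregman_gsb ::
    "('a::real_inner \<Rightarrow> ereal) \<Rightarrow> ('a \<Rightarrow> 'a) \<Rightarrow> ('a \<Rightarrow> 'a) \<Rightarrow> 'a \<Rightarrow> 'a \<Rightarrow> real"
  where "bregman_gsb \<Phi> A B f g =
    bregman \<Phi> f g + bregman \<Phi> g f
    + 1/2 * weighted_norm_sq A (f - g)
    + 1/2 * weighted_norm_sq B (grad \<Phi> f - grad \<Phi> g)"

text \<open>
  \<open>Metric_space S d\<close> demands nonnegativity and symmetry of \<open>d\<close> on the whole type, whereas the
  divergence is meaningful only on \<open>interior (effdom \<Phi>)\<close>; hence the value 0 elsewhere. As
  \<open>sqrt\<close> is negative at negative arguments, nonnegativity of the metric includes
  nonnegativity of \<open>bregman_gsb\<close> on \<open>interior (effdom \<Phi>)\<close>.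
\<close>

definition gsb_dist ::
    "('a::real_inner \<Rightarrow> ereal) \<Rightarrow> ('a \<Rightarrow> 'a) \<Rightarrow> ('a \<Rightarrow> 'a) \<Rightarrow> 'a \<Rightarrow> 'a \<Rightarrow> real"
  where "gsb_dist \<Phi> A B f g =
    (if f \<in> interior (effdom \<Phi>) \<and> g \<in> interior (effdom \<Phi>)
     then sqrt (bregman_gsb \<Phi> A B f g) else 0)"

definition block_op :: "('a::real_inner \<Rightarrow> 'a) \<Rightarrow> ('a \<Rightarrow> 'a) \<Rightarrow> 'a \<times> 'a \<Rightarrow> 'a \<times> 'a"
  where "block_op A B = (\<lambda>(f, g). (A f + g, f + B g))"

lemma bounded_linear_block_op:
  assumes "bounded_linear A" "bounded_linear B"
  shows "bounded_linear (block_op A B)"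
proof -
  have "bounded_linear (\<lambda>p. (A (fst p) + snd p, fst p + B (snd p)))"
    by (intro bounded_linear_Pair bounded_linear_add bounded_linear_fst bounded_linear_snd
        bounded_linear_compose[OF assms(1)] bounded_linear_compose[OF assms(2)])
  then show ?thesis
    by (simp add: block_op_def case_prod_beta')
qed

lemma self_adjoint_block_op:
  assumes "self_adjoint A" "self_adjoint B"
  shows "self_adjoint (block_op A B)"
  using assms unfolding self_adjoint_def block_op_def
  by (auto simp: inner_add_left inner_add_right)

end

theory Submission
  imports Defs
begin

text \<open>
  The symmetrised Bregman divergence telescopes to \<open>(f - g) \<bullet> (grad \<Phi> f - grad \<Phi> g)\<close>, so
  \<open>bregman_gsb\<close> is half the quadratic form of the block operator at the difference of the points
  \<open>(f, grad \<Phi> f)\<close>. If the block operator is positive semidefinite, the root of this form is a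
  seminorm; it separates points because the two divergences and the \<open>B\<close> term are nonnegative and
  \<open>A\<close> is positive definite. Under the sufficient condition, writing \<open>g = A h\<close> bounds the form at
  \<open>(f, g)\<close> from below by \<open>(f + h) \<bullet> A (f + h)\<close>.
\<close>

section \<open>Quadratic forms of self-adjoint operators\<close>

lemma pos_semidef_iff: "pos_semidef T \<longleftrightarrow> (\<forall>x. 0 \<le> x \<bullet> T x)"
  by (simp add: pos_semidef_def loewner_ge_def)

lemma self_adjoint_quadratic_expand:
  fixes T :: "'a::real_inner \<Rightarrow> 'a"
  assumes "linear T" "self_adjoint T"
  shows "(x + t *\<^sub>R y) \<bullet> T (x + t *\<^sub>R y) = x \<bullet> T x + 2 * t * (x \<bullet> T y) + t\<^sup>2 * (y \<bullet> T y)"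
proof -
  have "y \<bullet> T x = x \<bullet> T y"
    using assms(2) by (metis inner_commute self_adjoint_def)
  then show ?thesis
    by (simp add: linear_add[OF assms(1)] linear_scale[OF assms(1)] inner_add_left
        inner_add_right power2_eq_square algebra_simps)
qed

text \<open>Near 0 the linear term dominates. This is the first-order condition used for the energy
  minimiser below.\<close>

lemma linear_coeff_zero_if_quadratic_nonneg:
  fixes b c :: real
  assumes "\<And>t. 0 \<le> t * b + t\<^sup>2 * c"
  shows "b = 0"
proof (rule ccontr)
  assume b: "b \<noteq> 0"
  \<comment> \<open>The step length \<open>s\<close> keeps \<open>s * c\<close> below 1, so moving
    to \<open>t = - (s * b)\<close>, against the slope, gives a negative value.\<close>
  define s where "s = 1 / (\<bar>c\<bar> + 1)"
  have s: "0 < s" "s * c < 1"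
    by (auto simp: s_def field_simps)
  have "- (s * b) * b + (- (s * b))\<^sup>2 * c = s * b\<^sup>2 * (s * c - 1)"
    by (simp add: power2_eq_square algebra_simps)
  also have "\<dots> < 0"
    using s b by (simp add: mult_pos_neg)
  finally show False
    using assms[of "- (s * b)"] by simp
qed

text \<open>Discriminant argument: the form at \<open>x + t *\<^sub>R y\<close> is a nonnegative
  quadratic in \<open>t\<close>. As the form may be degenerate, its leading coefficient can
  vanish.\<close>

lemma pos_semidef_cauchy_schwarz:
  fixes T :: "'a::real_inner \<Rightarrow> 'a"
  assumes "linear T" "self_adjoint T" "pos_semidef T"
  shows "x \<bullet> T y \<le> sqrt (x \<bullet> T x) * sqrt (y \<bullet> T y)"
proof -
  have nonneg: "0 \<le> z \<bullet> T z" for z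
    using assms(3) by (simp add: pos_semidef_iff)
  have expand: "0 \<le> x \<bullet> T x + 2 * t * (x \<bullet> T y) + t\<^sup>2 * (y \<bullet> T y)" for t
    using nonneg[of "x + t *\<^sub>R y"] self_adjoint_quadratic_expand[OF assms(1,2)] by metis
  have "(x \<bullet> T y)\<^sup>2 \<le> (x \<bullet> T x) * (y \<bullet> T y)"
  proof (cases "y \<bullet> T y = 0")
    case True
    have "x \<bullet> T y = 0"
    proof (rule ccontr)
      assume "x \<bullet> T y \<noteq> 0"
      \<comment> \<open>The expansion is now affine in \<open>t\<close>, and this \<open>t\<close>
        gives it the value -1.\<close>
      then show False
        using expand[of "- (x \<bullet> T x + 1) / (2 * (x \<bullet> T y))"] True by (simp add: field_simps)
    qed
    then show ?thesis
      using True by simp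
  next
    case False
    then have pos: "0 < y \<bullet> T y"
      using nonneg[of y] by simp
    \<comment> \<open>Evaluate at the minimiser of the quadratic in \<open>t\<close>.\<close>
    have "0 \<le> x \<bullet> T x - (x \<bullet> T y)\<^sup>2 / (y \<bullet> T y)"
      using expand[of "- (x \<bullet> T y) / (y \<bullet> T y)"] pos
      by (simp add: power2_eq_square field_simps)
    then show ?thesis
      using pos by (simp add: field_simps)
  qed
  then have "x \<bullet> T y \<le> sqrt ((x \<bullet> T x) * (y \<bullet> T y))"
    using real_le_rsqrt by blast
  then show ?thesis
    by (simp add: real_sqrt_mult)
qed

lemma pos_semidef_sqrt_triangle:
  fixes T :: "'a::real_inner \<Rightarrow> 'a"
  assumes "linear T" "self_adjoint T" "pos_semidef T"
  shows "sqrt ((x + y) \<bullet> T (x + y)) \<le> sqrt (x \<bullet> T x) + sqrt (y \<bullet> T y)"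
proof (rule real_le_lsqrt)
  have nonneg: "0 \<le> z \<bullet> T z" for z
    using assms(3) by (simp add: pos_semidef_iff)
  show "0 \<le> sqrt (x \<bullet> T x) + sqrt (y \<bullet> T y)"
    using nonneg by simp
  show "(x + y) \<bullet> T (x + y) \<le> (sqrt (x \<bullet> T x) + sqrt (y \<bullet> T y))\<^sup>2"
    using self_adjoint_quadratic_expand[OF assms(1,2), of x 1 y]
      pos_semidef_cauchy_schwarz[OF assms, of x y] nonneg[of x] nonneg[of y]
    by (simp add: power2_sum)
qed

section \<open>Representation by strongly positive operators\<close>

text \<open>
  The representer minimises the energy \<open>x \<bullet> T x - 2 * l x\<close>; minimising sequences are Cauchy by the
  parallelogram identity.
\<close>

lemma strongly_pos_representation:
  fixes T :: "'a::{real_inner, complete_space} \<Rightarrow> 'a" and l :: "'a \<Rightarrow> real"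
  assumes T: "bounded_linear T" "self_adjoint T" "strongly_pos T" and l: "bounded_linear l"
  shows "\<exists>x. \<forall>h. l h = h \<bullet> T x"
proof -
  note linT = bounded_linear.linear[OF T(1)] and linl = bounded_linear.linear[OF l]
  obtain \<alpha> where \<alpha>: "0 < \<alpha>" "\<And>x. \<alpha> * (norm x)\<^sup>2 \<le> x \<bullet> T x"
    using T(3) by (auto simp: strongly_pos_def)
  obtain K where K: "\<And>x. norm (l x) \<le> norm x * K"
    using bounded_linear.bounded[OF l] by blast
  define J where "J x = x \<bullet> T x - 2 * l x" for x
  have J_expand: "J (x + t *\<^sub>R h) = J x + t * (2 * (h \<bullet> T x - l h)) + t\<^sup>2 * (h \<bullet> T h)" for x t h
  proof -
    have "x \<bullet> T h = h \<bullet> T x"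
      using T(2) by (metis inner_commute self_adjoint_def)
    then show ?thesis
      unfolding J_def self_adjoint_quadratic_expand[OF linT T(2)]
      by (simp add: linear_add[OF linl] linear_scale[OF linl] algebra_simps)
  qed
  \<comment> \<open>Strong positivity beats the linear growth of \<open>l\<close>; complete the
    square in \<open>norm x\<close>.\<close>
  have lower: "- (K\<^sup>2 / \<alpha>) \<le> J x" for x
  proof -
    have "0 \<le> (\<alpha> * norm x - K)\<^sup>2 / \<alpha>"
      using \<alpha>(1) by simp
    also have "\<dots> = \<alpha> * (norm x)\<^sup>2 - 2 * (norm x * K) + K\<^sup>2 / \<alpha>"
      using \<alpha>(1) by (simp add: power2_eq_square field_simps)
    finally show ?thesis
      using \<alpha>(2)[of x] K[of x] unfolding J_def by simp
  qed
  define m where "m = (INF x. J x)"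
  have bdd: "bdd_below (range J)"
    using lower by (auto simp: bdd_below_def)
  have m_le: "m \<le> J x" for x
    unfolding m_def using bdd by (intro cINF_lower) auto
  define \<delta> where "\<delta> n = 1 / real (Suc n)" for n
  have \<delta>_pos: "0 < \<delta> n" for n
    by (simp add: \<delta>_def)
  have \<delta>_lim: "\<delta> \<longlonglongrightarrow> 0"
    unfolding \<delta>_def by (rule LIMSEQ_Suc[OF lim_1_over_n])
  have "\<exists>x. J x < m + \<delta> n" for n
    using cINF_less_iff[OF _ bdd, of "m + \<delta> n"] \<delta>_pos[of n] by (auto simp: m_def)
  then obtain X where X: "\<And>n. J (X n) < m + \<delta> n"
    by metis
  \<comment> \<open>The midpoint is written as \<open>x + (1/2) *\<^sub>R (y - x)\<close> so that
    \<open>J_expand\<close> applies with \<open>t = 1/2\<close> and \<open>t = 1\<close>.\<close>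
  have parallelogram: "J x + J y - 2 * J (x + (1/2) *\<^sub>R (y - x)) = 1/2 * ((y - x) \<bullet> T (y - x))"
    for x y
    using J_expand[of x "1/2" "y - x"] J_expand[of x 1 "y - x"]
    by (simp add: power2_eq_square field_simps)
  \<comment> \<open>The energy of the midpoint is at least \<open>m\<close>, so the parallelogram
    identity leaves only the two excesses over \<open>m\<close>.\<close>
  have close: "\<alpha> * (norm (X j - X i))\<^sup>2 \<le> 2 * (\<delta> i + \<delta> j)" for i j
  proof -
    define z where "z = X i + (1/2) *\<^sub>R (X j - X i)"
    define r where "r = (X j - X i) \<bullet> T (X j - X i)"
    have "J (X i) + J (X j) - 2 * J z = r / 2"
      using parallelogram[of "X i" "X j"] by (simp add: z_def r_def)
    moreover have "\<alpha> * (norm (X j - X i))\<^sup>2 \<le> r"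
      unfolding r_def by (rule \<alpha>(2))
    ultimately show ?thesis
      using m_le[of z] X[of i] X[of j] by (simp add: field_simps)
  qed
  have "Cauchy X"
  proof (rule metric_CauchyI)
    fix e :: real
    assume e: "0 < e"
    have "0 < \<alpha> * e\<^sup>2 / 4"
      using \<alpha>(1) e by simp
    then obtain N where N: "\<And>n. N \<le> n \<Longrightarrow> \<delta> n < \<alpha> * e\<^sup>2 / 4"
      using order_tendstoD(2)[OF \<delta>_lim] unfolding eventually_sequentially by blast
    show "\<exists>N. \<forall>i\<ge>N. \<forall>j\<ge>N. dist (X i) (X j) < e"
    proof (intro exI allI impI)
      fix i j
      assume "N \<le> i" "N \<le> j"
      then have "\<delta> i < \<alpha> * e\<^sup>2 / 4" "\<delta> j < \<alpha> * e\<^sup>2 / 4"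
        using N by blast+
      then have "\<alpha> * (norm (X i - X j))\<^sup>2 < \<alpha> * e\<^sup>2"
        using close[of i j] by simp
      then have "(norm (X i - X j))\<^sup>2 < e\<^sup>2"
        using \<alpha>(1) by simp
      then show "dist (X i) (X j) < e"
        using power_less_imp_less_base e by (fastforce simp: dist_norm)
    qed
  qed
  then obtain x where lim: "X \<longlonglongrightarrow> x"
    using Cauchy_convergent convergent_def by blast
  have "(\<lambda>n. J (X n)) \<longlonglongrightarrow> J x"
    unfolding J_def
    by (intro tendsto_intros lim bounded_linear.tendsto[OF T(1)] bounded_linear.tendsto[OF l])
  moreover have "(\<lambda>n. m + \<delta> n) \<longlonglongrightarrow> m"
    using tendsto_add[OF tendsto_const \<delta>_lim, of m] by simp
  ultimately have "J x \<le> m"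
    by (rule LIMSEQ_le) (use X less_imp_le in blast)
  have "2 * (h \<bullet> T x - l h) = 0" for h
  proof (rule linear_coeff_zero_if_quadratic_nonneg[where c = "h \<bullet> T h"])
    show "0 \<le> t * (2 * (h \<bullet> T x - l h)) + t\<^sup>2 * (h \<bullet> T h)" for t
      using m_le[of "x + t *\<^sub>R h"] \<open>J x \<le> m\<close> J_expand[of x t h] by linarith
  qed
  then have "\<forall>h. l h = h \<bullet> T x"
    by simp
  then show ?thesis ..
qed

corollary riesz_representation:
  fixes l :: "'a::{real_inner, complete_space} \<Rightarrow> real"
  assumes "bounded_linear l"
  shows "\<exists>x. \<forall>h. l h = h \<bullet> x"
proof (rule strongly_pos_representation[OF bounded_linear_ident _ _ assms])
  show "self_adjoint (\<lambda>x. x)"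
    by (simp add: self_adjoint_def)
  show "strongly_pos (\<lambda>x. x)"
    unfolding strongly_pos_def
    by (intro exI[of _ 1]) (simp add: power2_norm_eq_inner)
qed

text \<open>Representing the functional \<open>\<lambda>h. h \<bullet> y\<close> through
  \<open>T\<close> yields a preimage of \<open>y\<close>.\<close>

corollary strongly_pos_surj:
  fixes T :: "'a::{real_inner, complete_space} \<Rightarrow> 'a"
  assumes "bounded_linear T" "self_adjoint T" "strongly_pos T"
  shows "surj T"
  unfolding surj_def
proof
  fix y
  obtain x where "\<forall>h. h \<bullet> y = h \<bullet> T x"
    using strongly_pos_representation[OF assms bounded_linear_inner_left[of y]] by (rule exE)
  then have "y = T x"
    by (simp only: vector_eq_ldot)
  then show "\<exists>x. y = T x" ..
qed

section \<open>The sufficient condition for positive semidefiniteness\<close>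

lemma pos_def_inj:
  fixes T :: "'a::real_inner \<Rightarrow> 'a"
  assumes "linear T" "pos_def T"
  shows "inj T"
proof (subst linear_injective_0[OF assms(1)], intro allI impI)
  show "x = 0" if "T x = 0" for x
    using assms(2) that by (metis inner_zero_right less_irrefl pos_def_def)
qed

lemma pos_semidef_block_op:
  fixes A B :: "'a::{real_inner, complete_space} \<Rightarrow> 'a"
  assumes A: "bounded_linear A" "self_adjoint A" "pos_def A" "strongly_pos A"
    and B: "loewner_ge B (inv A)"
  shows "pos_semidef (block_op A B)"
proof -
  note linA = bounded_linear.linear[OF A(1)]
  have "0 \<le> f \<bullet> A f + 2 * (f \<bullet> g) + g \<bullet> B g" for f g
  proof -
    obtain h where h: "g = A h"
      using strongly_pos_surj[OF A(1,2,4)] by blast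
    \<comment> \<open>\<open>inv\<close> merely chooses some preimage; injectivity of
      \<open>A\<close> identifies it with \<open>h\<close>.\<close>
    have "inv A g = h"
      unfolding h by (rule inv_f_f[OF pos_def_inj[OF linA A(3)]])
    then have "g \<bullet> h \<le> g \<bullet> B g"
      using B[unfolded loewner_ge_def, rule_format, of g] by (simp add: inner_diff_right)
    moreover have "g \<bullet> h = h \<bullet> A h"
      by (simp add: h inner_commute)
    moreover have "0 \<le> (f + h) \<bullet> A (f + h)"
      using A(3) by (cases "f + h = 0") (auto simp: pos_def_def intro: less_imp_le)
    ultimately show ?thesis
      using self_adjoint_quadratic_expand[OF linA A(2), of f 1 h] h by simp
  qed
  moreover have "(f, g) \<bullet> block_op A B (f, g) = f \<bullet> A f + 2 * (f \<bullet> g) + g \<bullet> B g" for f g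
    using inner_commute[of g f] by (simp add: block_op_def inner_add_right)
  ultimately show ?thesis
    by (simp add: pos_semidef_iff split_paired_all)
qed

section \<open>Bregman divergences of generators\<close>

text \<open>Justifies the definite description in \<open>grad\<close>: existence comes from Riesz
  representation, uniqueness from that of the derivative.\<close>

lemma generator_gderiv_grad:
  fixes \<Phi> :: "'a::{real_inner, complete_space} \<Rightarrow> ereal"
  assumes "generator \<Phi>" "g \<in> interior (effdom \<Phi>)"
  shows "GDERIV (real_of_ereal \<circ> \<Phi>) g :> grad \<Phi> g"
proof -
  obtain l where l: "((real_of_ereal \<circ> \<Phi>) has_derivative l) (at g)"
    using assms unfolding generator_def differentiable_def by blast
  obtain D where "\<forall>h. l h = h \<bullet> D"
    using riesz_representation[OF has_derivative_bounded_linear[OF l]] by (rule exE)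
  then have "l = (\<lambda>h. h \<bullet> D)"
    by (simp add: fun_eq_iff)
  then have D: "GDERIV (real_of_ereal \<circ> \<Phi>) g :> D"
    using l by (simp add: gderiv_def)
  moreover have "D' = D" if "GDERIV (real_of_ereal \<circ> \<Phi>) g :> D'" for D'
  proof -
    have "(\<lambda>h. h \<bullet> D') = (\<lambda>h. h \<bullet> D)"
      using that D unfolding gderiv_def by (rule has_derivative_unique)
    then have "\<forall>h. h \<bullet> D' = h \<bullet> D"
      by (simp add: fun_eq_iff)
    then show ?thesis
      by (simp only: vector_eq_ldot)
  qed
  ultimately show ?thesis
    unfolding grad_def by (rule theI)
qed

text \<open>Gradient inequality: convexity bounds the difference quotients on the segment from
  \<open>g\<close> to \<open>f\<close> by \<open>F f - F g\<close>; let \<open>t\<close> decrease to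
  0.\<close>

lemma bregman_nonneg:
  fixes \<Phi> :: "'a::{real_inner, complete_space} \<Rightarrow> ereal"
  assumes gen: "generator \<Phi>" and f: "f \<in> effdom \<Phi>" and g: "g \<in> interior (effdom \<Phi>)"
  shows "0 \<le> bregman \<Phi> f g"
proof (cases "f = g")
  case True
  then show ?thesis
    by (simp add: bregman_def)
next
  case False
  define F where "F = real_of_ereal \<circ> \<Phi>"
  have gdom: "g \<in> effdom \<Phi>"
    using g interior_subset by blast
  have finite: "\<Phi> x = ereal (F x)" if "x \<in> effdom \<Phi>" for x
    using gen that unfolding generator_def proper_fun_def by (cases "\<Phi> x") (auto simp: F_def effdom_def)
  have convex: "F (g + t *\<^sub>R (f - g)) - F g \<le> t * (F f - F g)" if t: "0 < t" "t < 1" for t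
  proof -
    have "\<Phi> ((1 - t) *\<^sub>R g + t *\<^sub>R f) < ereal (1 - t) * \<Phi> g + ereal t * \<Phi> f"
      using gen f gdom t False unfolding generator_def strictly_convex_def by metis
    then have less: "\<Phi> (g + t *\<^sub>R (f - g)) < ereal ((1 - t) * F g + t * F f)"
      using finite[OF f] finite[OF gdom] by (simp add: algebra_simps)
    \<comment> \<open>The finite upper bound puts the segment point in the effective domain, which
      permits passing to real values.\<close>
    then have "g + t *\<^sub>R (f - g) \<in> effdom \<Phi>"
      by (auto simp: effdom_def)
    then show ?thesis
      using less finite by (simp add: algebra_simps)
  qed
  have "(F has_derivative (\<lambda>h. h \<bullet> grad \<Phi> g)) (at g)"
    using generator_gderiv_grad[OF gen g] by (simp add: gderiv_def F_def)
  then have "((\<lambda>t. F (g + t *\<^sub>R (f - g))) has_derivative (\<lambda>t. (t *\<^sub>R (f - g)) \<bullet> grad \<Phi> g)) (at 0)"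
    by (intro has_derivative_compose[where g = F and f = "\<lambda>t. g + t *\<^sub>R (f - g)" and x = 0])
      (auto intro!: derivative_eq_intros)
  then have "((\<lambda>t. F (g + t *\<^sub>R (f - g))) has_real_derivative (f - g) \<bullet> grad \<Phi> g) (at 0)"
    by (simp add: has_field_derivative_def mult_commute_abs)
  \<comment> \<open>Only the one-sided limit is taken, since convexity controls the quotient for
    \<open>0 < t\<close> and \<open>t < 1\<close>.\<close>
  then have "((\<lambda>t. (F (g + t *\<^sub>R (f - g)) - F g) / t) \<longlongrightarrow> (f - g) \<bullet> grad \<Phi> g) (at_right 0)"
    by (auto simp: DERIV_def intro: tendsto_mono[OF at_le])
  moreover have "\<forall>\<^sub>F t in at_right 0. (F (g + t *\<^sub>R (f - g)) - F g) / t \<le> F f - F g"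
    unfolding eventually_at_right_field
    using convex by (intro exI[of _ 1]) (auto simp: divide_le_eq mult.commute)
  ultimately have "(f - g) \<bullet> grad \<Phi> g \<le> F f - F g"
    by (rule tendsto_upperbound) simp
  then show ?thesis
    by (simp add: bregman_def F_def inner_commute)
qed

section \<open>The metric induced by the block operator\<close>

lemma bregman_gsb_eq_block_op:
  fixes \<Phi> :: "'a::real_inner \<Rightarrow> ereal" and f g :: 'a
  defines "p \<equiv> (f - g, grad \<Phi> f - grad \<Phi> g)"
  shows "bregman_gsb \<Phi> A B f g = 1/2 * (p \<bullet> block_op A B p)"
  unfolding p_def bregman_gsb_def bregman_def weighted_norm_sq_def block_op_def
  by (simp add: inner_diff_left inner_diff_right inner_add_right inner_commute algebra_simps)

text \<open>Point separation is read off the summands, because a semidefinite block form may vanish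
  at nonzero vectors. \<open>B 0 = 0\<close> covers equal gradients.\<close>

lemma bregman_gsb_pos:
  fixes \<Phi> :: "'a::{real_inner, complete_space} \<Rightarrow> ereal"
  assumes "generator \<Phi>" "pos_def A" "pos_def B" "B 0 = 0"
    and "f \<in> interior (effdom \<Phi>)" "g \<in> interior (effdom \<Phi>)" "f \<noteq> g"
  shows "0 < bregman_gsb \<Phi> A B f g"
proof -
  have "0 \<le> bregman \<Phi> f g" "0 \<le> bregman \<Phi> g f"
    using assms(1,5,6) interior_subset by (blast intro: bregman_nonneg)+
  moreover have "0 < weighted_norm_sq A (f - g)"
    using assms(2,7) by (simp add: weighted_norm_sq_def pos_def_def)
  moreover have "0 \<le> weighted_norm_sq B (grad \<Phi> f - grad \<Phi> g)"
    using assms(3,4) unfolding weighted_norm_sq_def pos_def_def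
    by (metis inner_zero_left less_imp_le order_refl)
  ultimately show ?thesis
    by (simp add: bregman_gsb_def)
qed

lemma Metric_space_gsb_dist:
  fixes \<Phi> :: "'a::{real_inner, complete_space} \<Rightarrow> ereal"
  assumes gen: "generator \<Phi>"
    and A: "bounded_linear A" "self_adjoint A" "pos_def A"
    and B: "bounded_linear B" "self_adjoint B" "pos_def B"
    and M: "pos_semidef (block_op A B)"
  shows "Metric_space (interior (effdom \<Phi>)) (gsb_dist \<Phi> A B)"
proof
  let ?S = "interior (effdom \<Phi>)"
  define q where "q p = p \<bullet> block_op A B p" for p
  define P where "P f = (f, grad \<Phi> f)" for f
  note linM = bounded_linear.linear[OF bounded_linear_block_op[OF A(1) B(1)]]
  have gsb: "bregman_gsb \<Phi> A B f g = 1/2 * q (P f - P g)" for f g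
    by (simp add: bregman_gsb_eq_block_op q_def P_def)
  have q_minus: "q (- p) = q p" for p
    by (simp add: q_def linear_neg[OF linM])
  have q_nonneg: "0 \<le> q p" for p
    using M unfolding q_def pos_semidef_iff ..
  show "0 \<le> gsb_dist \<Phi> A B f g" for f g
    by (simp add: gsb_dist_def gsb q_nonneg)
  show "gsb_dist \<Phi> A B f g = gsb_dist \<Phi> A B g f" for f g
    using q_minus[of "P f - P g"] by (simp add: gsb_dist_def gsb)
  show "gsb_dist \<Phi> A B f g = 0 \<longleftrightarrow> f = g" if "f \<in> ?S" "g \<in> ?S" for f g
  proof (cases "f = g")
    case True
    then show ?thesis
      by (simp add: gsb_dist_def gsb q_def)
  next
    case False
    then have "0 < bregman_gsb \<Phi> A B f g"
      using bregman_gsb_pos[OF gen A(3) B(3)] that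
        linear_0[OF bounded_linear.linear[OF B(1)]] by blast
    then show ?thesis
      using False that by (simp add: gsb_dist_def)
  qed
  show "gsb_dist \<Phi> A B f h \<le> gsb_dist \<Phi> A B f g + gsb_dist \<Phi> A B g h"
    if "f \<in> ?S" "g \<in> ?S" "h \<in> ?S" for f g h
  proof -
    \<comment> \<open>\<open>P f - P h\<close> is the sum of the two other differences, so this is
      the seminorm triangle inequality; the factor 1/2 then contributes a common denominator
      \<open>sqrt 2\<close>.\<close>
    have "sqrt (q (P f - P h)) \<le> sqrt (q (P f - P g)) + sqrt (q (P g - P h))"
      using pos_semidef_sqrt_triangle[OF linM self_adjoint_block_op[OF A(2) B(2)] M,
          of "P f - P g" "P g - P h"]
      by (simp add: q_def)
    then show ?thesis
      using that by (simp add: gsb_dist_def gsb real_sqrt_divide add_divide_distrib[symmetric]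
          divide_right_mono)
  qed
qed

theorem theorem13:
  fixes \<Phi> :: "'a::{real_inner, complete_space} \<Rightarrow> ereal"
    and A B :: "'a \<Rightarrow> 'a"
  assumes "generator \<Phi>"
    and "bounded_linear A" and "self_adjoint A" and "pos_def A"
    and "bounded_linear B" and "self_adjoint B" and "pos_def B"
  shows "(pos_semidef (block_op A B) \<longrightarrow>
            Metric_space (interior (effdom \<Phi>)) (gsb_dist \<Phi> A B)) \<and>
         (strongly_pos A \<and> loewner_ge B (inv A) \<longrightarrow> pos_semidef (block_op A B))"
  using Metric_space_gsb_dist[OF assms] pos_semidef_block_op[OF assms(2-4)] by blast

end
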